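(* Let $R$ be a commutative ring with identity and let $\mathbf a=(a_n)_{n\ge 0},\mathbf b=(b_n)_{n\ge0}\in\mathcal W(R)$, with characteristic polynomials $p_a(t)$ of degree $M$ and $p_b(t)$ of degree $N$. Then the Hurwitz product $\mathbf r=\mathbf a\star\mathbf b$ belongs to $\mathcal W(R)$, and $\mathbf r$ has characteristic polynomial $\operatorname{res}(p_a(x),p_b(t-x))$, where $p_b(t-x)$ is regarded as a polynomial in $t$; that is, the polynomial $\prod_{i=1}^{M}\prod_{j=1}^{N}(t-\alpha_i-\beta_j)$, where $\alpha_1,\dots,\alpha_M$ are the roots of $p_a$ and $\beta_1,\dots,\beta_N$ are the roots of $p_b$. Moreover, $(\mathcal W(R),+,\star)$ is an $R$-algebra.
   Context: $\mathcal S(R)$ denotes the set of all sequences $\mathbf a=(a_n)_{n\ge0}$ with $a_n\in R$. A sequence $\mathbf a\in\mathcal S(R)$ is a linear recurrent sequence with (monic) characteristic polynomial $p_a(t)=t^N-\sum_{i=1}^{N}h_it^{N-i}\in R[t]$ if $a_n=\sum_{i=1}^{N}h_ia_{n-i}$ for all $n\ge N$; the characteristic polynomial need not be the minimal one. $\mathcal W(R)\subset\mathcal S(R)$ is the set of all linear recurrent sequences. Operations on $\mathcal S(R)$: componentwise sum $(\mathbf a+\mathbf b)_n=a_n+b_n$; Hurwitz (binomial convolution) product $(\mathbf a\star\mathbf b)_n=\sum_{i=0}^n\binom{n}{i}a_ib_{n-i}$. For monic polynomials $f,g$ with roots $\alpha_i$ (for $f$, of degree $M$) and $\beta_j$ (for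 $g$, of degree $N$), the resultant is $\operatorname{res}(f,g)=\prod_{i=1}^M\prod_{j=1}^N(\alpha_i-\beta_j)$ (roots taken in a suitable extension; the result is a polynomial expression in the coefficients, so lies in the coefficient ring). *)

theory Defs
  imports Jordan_Normal_Form.VS_Connect Subresultants.Resultant_Prelim
begin

text \<open>
  Writing p = t^N - (h_1 t^(N-1) + ... + h_N), the coefficient h_i is minus the
  coefficient of t^(N-i) in p. The polynomial p is not required to be minimal.
\<close>

definition has_char_poly :: "(nat \<Rightarrow> 'a::comm_ring_1) \<Rightarrow> 'a poly \<Rightarrow> bool" where
  "has_char_poly a p \<longleftrightarrow>
     lead_coeff p = 1 \<and>
     (\<forall>n\<ge>degree p. a n = (\<Sum>i=1..degree p. (- coeff p (degree p - i)) * a (n - i)))"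

definition linrec_seqs :: "(nat \<Rightarrow> 'a::comm_ring_1) set" where
  "linrec_seqs = {a. \<exists>p. has_char_poly a p}"

definition hurwitz :: "(nat \<Rightarrow> 'a::comm_ring_1) \<Rightarrow> (nat \<Rightarrow> 'a) \<Rightarrow> (nat \<Rightarrow> 'a)"
    (infixl "\<star>" 70) where
  "a \<star> b = (\<lambda>n. \<Sum>i=0..n. of_nat (n choose i) * a i * b (n - i))"

definition linrec_algebra :: "('a::comm_ring_1, nat \<Rightarrow> 'a) module" where
  "linrec_algebra =
     \<lparr> carrier = linrec_seqs,
       monoid.mult = hurwitz,
       one = (\<lambda>n. if n = 0 then 1 else 0),
       zero = (\<lambda>n. 0),
       add = (\<lambda>a b n. a n + b n),
       module.smult = (\<lambda>c a n. c * a n) \<rparr>"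

text \<open>
  Bivariate polynomials are elements of R[t][x]: the outer variable of
  \<^typ>\<open>'a poly poly\<close> is x, the inner one is t. Thus the constant
  \<^term>\<open>[:0, 1:]\<close> of R[t] is t, and \<^term>\<open>[:[:0, 1:], -1:]\<close> is t - x.
  The resultant of two such polynomials eliminates x and lies in R[t].
\<close>

definition poly_in_x :: "'a::comm_ring_1 poly \<Rightarrow> 'a poly poly" where
  "poly_in_x p = map_poly (\<lambda>c. [:c:]) p"

definition poly_t_minus_x :: "'a::comm_ring_1 poly \<Rightarrow> 'a poly poly" where
  "poly_t_minus_x p = pcompose (poly_in_x p) [:[:0, 1:], -1:]"

end

theory Submission
  imports Defs Subresultants.Subresultant
begin

text \<open>
  Let the linear functional E on R[x, y] send x^i y^j to a_i b_j. Then E((x + y)^n) is the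
  n-th term of the Hurwitz product, and E vanishes on the ideal generated by p_a(x) and
  p_b(y). Putting t = x + y, the resultant r(t) of p_a(x) and p_b(t - x) lies in this ideal,
  so E(t^n r(t)) = 0 for all n: r annihilates the Hurwitz product. It is monic because giving
  x and t weight 1 makes the top-weight part of the Sylvester matrix unitriangular.

  R may have zero divisors, so the factorization of r cannot be read off from its roots.
  It follows from res((x - c) f, g) = g(c) res(f, g), which holds over every commutative ring
  by row and column operations on the Sylvester matrix.
\<close>

section \<open>The ring structure of the Hurwitz product\<close>

text \<open>Reading a sequence as an exponential generating function, this is differentiation, and
  the Hurwitz product is multiplication.\<close>

definition shift :: "(nat \<Rightarrow> 'a) \<Rightarrow> nat \<Rightarrow> 'a" where
  "shift a = (\<lambda>n. a (Suc n))"

lemma shift_apply [simp]: "shift a n = a (Suc n)"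
  by (simp add: shift_def)

lemma hurwitz_0 [simp]: "(a \<star> b) 0 = a 0 * b 0"
  by (simp add: hurwitz_def)

text \<open>Leibniz rule, obtained from Pascal's rule. It lets the ring laws go by induction on the
  index instead of by reindexing multinomial sums.\<close>

lemma hurwitz_Suc: "(a \<star> b) (Suc n) = (shift a \<star> b) n + (a \<star> shift b) n"
proof -
  define T where "T i = a i * b (Suc n - i)" for i
  have "(a \<star> b) (Suc n) = (\<Sum>i\<le>Suc n. of_nat (Suc n choose i) * T i)"
    by (simp add: hurwitz_def T_def atMost_atLeast0 mult.assoc)
  also have "\<dots> = T 0 + (\<Sum>i\<le>n. of_nat ((n choose i) + (n choose Suc i)) * T (Suc i))"
    by (subst sum.atMost_Suc_shift) simp
  also have "\<dots> = (\<Sum>i\<le>n. of_nat (n choose i) * T (Suc i))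
      + (T 0 + (\<Sum>i\<le>n. of_nat (n choose Suc i) * T (Suc i)))"
    by (simp add: algebra_simps sum.distrib)
  also have "T 0 + (\<Sum>i\<le>n. of_nat (n choose Suc i) * T (Suc i)) = (\<Sum>i\<le>Suc n. of_nat (n choose i) * T i)"
    by (subst sum.atMost_Suc_shift) simp
  also have "\<dots> = (\<Sum>i\<le>n. of_nat (n choose i) * T i)"
    by (simp add: binomial_eq_0)
  also have "(\<Sum>i\<le>n. of_nat (n choose i) * T i) = (a \<star> shift b) n"
    by (auto simp: hurwitz_def T_def atMost_atLeast0 mult.assoc Suc_diff_le intro!: sum.cong)
  also have "(\<Sum>i\<le>n. of_nat (n choose i) * T (Suc i)) = (shift a \<star> b) n"
    by (simp add: hurwitz_def T_def atMost_atLeast0 mult.assoc)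
  finally show ?thesis .
qed

lemma shift_hurwitz: "shift (a \<star> b) = (\<lambda>n. (shift a \<star> b) n + (a \<star> shift b) n)"
  by (simp add: fun_eq_iff hurwitz_Suc)

lemma hurwitz_commute: "a \<star> b = b \<star> a"
proof
  show "(a \<star> b) n = (b \<star> a) n" for n
    by (induction n arbitrary: a b) (simp_all add: hurwitz_Suc mult.commute add.commute)
qed

lemma hurwitz_add_left: "(\<lambda>n. a n + b n) \<star> c = (\<lambda>n. (a \<star> c) n + (b \<star> c) n)"
  by (simp add: hurwitz_def algebra_simps sum.distrib)

lemma hurwitz_add_right: "c \<star> (\<lambda>n. a n + b n) = (\<lambda>n. (c \<star> a) n + (c \<star> b) n)"
  by (simp add: hurwitz_def algebra_simps sum.distrib)

lemma hurwitz_scale_left: "(\<lambda>n. c * a n) \<star> b = (\<lambda>n. c * (a \<star> b) n)"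
  by (simp add: hurwitz_def sum_distrib_left algebra_simps)

lemma hurwitz_scale_right: "b \<star> (\<lambda>n. c * a n) = (\<lambda>n. c * (b \<star> a) n)"
  by (simp add: hurwitz_def sum_distrib_left algebra_simps)

lemma hurwitz_zero_left [simp]: "(\<lambda>n. 0) \<star> b = (\<lambda>n. 0)"
  by (simp add: hurwitz_def)

lemma hurwitz_zero_right [simp]: "b \<star> (\<lambda>n. 0) = (\<lambda>n. 0)"
  by (simp add: hurwitz_def)

text \<open>By Leibniz both sides expand into three terms, each shifting one factor; hence the
  induction keeps all three sequences arbitrary.\<close>

lemma hurwitz_assoc: "(a \<star> b) \<star> c = a \<star> (b \<star> c)"
proof
  show "((a \<star> b) \<star> c) n = (a \<star> (b \<star> c)) n" for n
    by (induction n arbitrary: a b c)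
      (simp_all add: hurwitz_Suc shift_hurwitz hurwitz_add_left hurwitz_add_right algebra_simps)
qed

lemma hurwitz_one_left: "(\<lambda>n. if n = 0 then 1 else 0) \<star> a = a"
proof
  have shift_one: "shift (\<lambda>n. if n = 0 then 1 else 0 :: 'a) = (\<lambda>n. 0)"
    by (simp add: fun_eq_iff)
  show "((\<lambda>n. if n = 0 then 1 else 0) \<star> a) n = a n" for n
    by (induction n arbitrary: a) (simp_all add: hurwitz_Suc shift_one)
qed

section \<open>Linear recurrences and annihilating polynomials\<close>

text \<open>Sequences form the dual module of R[x], and this evaluates the functional a. The sum
  stops at the degree, so linearity is derived from \<open>pairing_pCons\<close>.\<close>

definition pairing :: "(nat \<Rightarrow> 'a::comm_ring_1) \<Rightarrow> 'a poly \<Rightarrow> 'a" where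
  "pairing a p = (\<Sum>i\<le>degree p. coeff p i * a i)"

lemma pairing_0 [simp]: "pairing a 0 = 0"
  by (simp add: pairing_def)

lemma pairing_pCons [simp]: "pairing a (pCons c p) = c * a 0 + pairing (shift a) p"
  by (cases "p = 0") (simp_all add: pairing_def sum.atMost_Suc_shift del: sum.atMost_Suc)

lemma pairing_add: "pairing a (p + q) = pairing a p + pairing a q"
  by (induction p q arbitrary: a rule: poly_induct2) (simp_all add: algebra_simps)

lemma pairing_smult: "pairing a (Polynomial.smult c p) = c * pairing a p"
  by (induction p arbitrary: a) (simp_all add: algebra_simps)

lemma pairing_add_seq: "pairing (\<lambda>n. a n + b n) p = pairing a p + pairing b p"
  by (simp add: pairing_def algebra_simps sum.distrib)

lemma pairing_scale_seq: "pairing (\<lambda>n. c * a n) p = c * pairing a p"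
  by (simp add: pairing_def sum_distrib_left algebra_simps)

lemma pairing_zero_seq [simp]: "pairing (\<lambda>n. 0) p = 0"
  by (simp add: pairing_def)

lemma pairing_uminus: "pairing a (- p) = - pairing a p"
  by (simp add: pairing_def sum_negf)

lemma pairing_monom_mult: "pairing a (Polynomial.monom 1 n * p) = pairing (\<lambda>i. a (n + i)) p"
proof (induction n arbitrary: a)
  case (Suc n)
  show ?case
    by (simp add: Polynomial.monom_Suc Suc.IH)
qed (simp add: monom_0 one_pCons [symmetric])

text \<open>R[x] acts on sequences with x acting as \<open>shift\<close>; this is p applied to
  a.\<close>

definition recurrence_op :: "'a::comm_ring_1 poly \<Rightarrow> (nat \<Rightarrow> 'a) \<Rightarrow> nat \<Rightarrow> 'a" where
  "recurrence_op p a n = pairing (\<lambda>i. a (n + i)) p"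

lemma recurrence_op_0 [simp]: "recurrence_op 0 a = (\<lambda>n. 0)"
  by (simp add: recurrence_op_def fun_eq_iff)

lemma recurrence_op_pCons [simp]:
  "recurrence_op (pCons c p) a = (\<lambda>n. c * a n + recurrence_op p (shift a) n)"
  by (simp add: recurrence_op_def fun_eq_iff shift_def)

lemma recurrence_op_1 [simp]: "recurrence_op 1 a = a"
  by (simp add: recurrence_op_def pairing_def fun_eq_iff)

lemma recurrence_op_shift: "recurrence_op p (shift a) = shift (recurrence_op p a)"
  by (simp add: recurrence_op_def fun_eq_iff)

text \<open>Multiplication by p is adjoint to the action of p on sequences: each factor x of q
  shifts the sequence, and shifting commutes with the action.\<close>

lemma pairing_mult: "pairing a (p * q) = pairing (recurrence_op p a) q"
proof (induction q arbitrary: a)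
  case (pCons c q)
  show ?case
    by (simp add: pairing_add pairing_smult pCons.IH recurrence_op_shift del: shift_apply)
       (simp add: recurrence_op_def [of _ _ 0])
qed simp

text \<open>Monicity isolates the term a(n + N), so the recurrence at index n + N is the vanishing
  at n of p applied to a.\<close>

lemma has_char_poly_iff:
  "has_char_poly a p \<longleftrightarrow> lead_coeff p = 1 \<and> recurrence_op p a = (\<lambda>n. 0)"
proof -
  define N where "N = degree p"
  have window: "recurrence_op p a n = a (n + N) - (\<Sum>i=1..N. (- coeff p (N - i)) * a (n + N - i))"
    if "lead_coeff p = 1" for n
  proof -
    have "recurrence_op p a n = a (n + N) + (\<Sum>i<N. coeff p i * a (n + i))"
      using that by (simp add: recurrence_op_def pairing_def N_def lessThan_Suc_atMost [symmetric] add.commute)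
    \<comment> \<open>The recurrence counts backwards from the newest term, hence the reversal of
      indices.\<close>
    also have "(\<Sum>i<N. coeff p i * a (n + i)) = (\<Sum>i=1..N. coeff p (N - i) * a (n + N - i))"
      by (rule sum.reindex_bij_witness [of _ "\<lambda>i. N - i" "\<lambda>i. N - i"]) auto
    finally show ?thesis
      by (simp add: sum_negf)
  qed
  show ?thesis
  proof (cases "lead_coeff p = 1")
    case True
    have "(\<forall>n\<ge>N. a n = (\<Sum>i=1..N. (- coeff p (N - i)) * a (n - i)))
        \<longleftrightarrow> (\<forall>n. recurrence_op p a n = 0)"
    proof (intro iffI allI impI)
      fix n assume *: "\<forall>n\<ge>N. a n = (\<Sum>i=1..N. (- coeff p (N - i)) * a (n - i))"
      show "recurrence_op p a n = 0"
        unfolding window [OF True] using * [rule_format, of "n + N"] by simp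
    next
      fix n assume "\<forall>n. recurrence_op p a n = 0" and "N \<le> n"
      then show "a n = (\<Sum>i=1..N. (- coeff p (N - i)) * a (n - i))"
        using window [OF True, of "n - N"] by (simp add: sum_negf eq_neg_iff_add_eq_0)
    qed
    with True show ?thesis
      by (simp add: has_char_poly_def N_def fun_eq_iff)
  qed (simp add: has_char_poly_def)
qed

lemma recurrence_op_mult: "recurrence_op (p * q) a = recurrence_op q (recurrence_op p a)"
proof
  fix n
  have "recurrence_op (p * q) a n = pairing (recurrence_op p (\<lambda>i. a (n + i))) q"
    by (simp add: recurrence_op_def [of "p * q"] pairing_mult)
  also have "recurrence_op p (\<lambda>i. a (n + i)) = (\<lambda>i. recurrence_op p a (n + i))"
    by (simp add: recurrence_op_def fun_eq_iff add.assoc)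
  finally show "recurrence_op (p * q) a n = recurrence_op q (recurrence_op p a) n"
    by (simp add: recurrence_op_def [of q])
qed

lemma recurrence_op_zero_seq [simp]: "recurrence_op p (\<lambda>n. 0) = (\<lambda>n. 0)"
  by (simp add: recurrence_op_def fun_eq_iff)

lemma recurrence_op_add_seq:
  "recurrence_op p (\<lambda>n. a n + b n) = (\<lambda>n. recurrence_op p a n + recurrence_op p b n)"
  by (simp add: recurrence_op_def fun_eq_iff pairing_add_seq)

lemma recurrence_op_scale_seq:
  "recurrence_op p (\<lambda>n. c * a n) = (\<lambda>n. c * recurrence_op p a n)"
  by (simp add: recurrence_op_def fun_eq_iff pairing_scale_seq)

section \<open>Closure of the linear recurrent sequences and the algebra axioms\<close>

lemma linrec_seqs_scale: "a \<in> linrec_seqs \<Longrightarrow> (\<lambda>n. c * a n) \<in> linrec_seqs"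
  by (auto simp: linrec_seqs_def has_char_poly_iff recurrence_op_scale_seq)

text \<open>The product of the two annihilators kills both summands, and monic times monic is monic
  even with zero divisors.\<close>

lemma linrec_seqs_add:
  assumes "a \<in> linrec_seqs" "b \<in> linrec_seqs"
  shows "(\<lambda>n. a n + b n) \<in> linrec_seqs"
proof -
  obtain p q where p: "lead_coeff p = 1" "recurrence_op p a = (\<lambda>n. 0)"
    and q: "lead_coeff q = 1" "recurrence_op q b = (\<lambda>n. 0)"
    using assms by (auto simp: linrec_seqs_def has_char_poly_iff)
  have "recurrence_op (p * q) a = (\<lambda>n. 0)"
    by (simp add: recurrence_op_mult p)
  moreover have "recurrence_op (p * q) b = (\<lambda>n. 0)"
    by (simp add: mult.commute [of p] recurrence_op_mult q)
  moreover have "lead_coeff (p * q) = 1"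
    using p(1) q(1) by (cases "q = 0") (simp_all add: degree_monic_mult lcoeff_monic_mult)
  ultimately have "has_char_poly (\<lambda>n. a n + b n) (p * q)"
    by (simp add: has_char_poly_iff recurrence_op_add_seq)
  then show ?thesis
    by (auto simp: linrec_seqs_def)
qed

lemma linrec_seqs_zero: "(\<lambda>n. 0) \<in> linrec_seqs"
proof -
  have "has_char_poly (\<lambda>n. 0) 1"
    by (simp add: has_char_poly_iff)
  then show ?thesis
    by (auto simp: linrec_seqs_def)
qed

lemma linrec_seqs_one: "(\<lambda>n. if n = 0 then 1 else 0) \<in> linrec_seqs"
proof -
  have "has_char_poly (\<lambda>n. if n = 0 then 1 else 0 :: 'a) [:0, 1:]"
    by (simp add: has_char_poly_iff fun_eq_iff)
  then show ?thesis
    by (auto simp: linrec_seqs_def)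
qed

text \<open>Closure under the Hurwitz product is a hypothesis because it will come from the
  resultant; the ring identities already hold for all sequences.\<close>

lemma algebra_linrec:
  assumes closed: "\<And>a b :: nat \<Rightarrow> 'a::comm_ring_1.
      a \<in> linrec_seqs \<Longrightarrow> b \<in> linrec_seqs \<Longrightarrow> a \<star> b \<in> linrec_seqs"
  shows "algebra (class_ring :: 'a ring) linrec_algebra"
proof (rule algebraI)
  show "cring (class_ring :: 'a ring)"
    by (rule class_cring.cring_axioms)
  show "cring (linrec_algebra :: ('a, nat \<Rightarrow> 'a) module)"
  proof (rule cringI)
    show "abelian_group (linrec_algebra :: ('a, nat \<Rightarrow> 'a) module)"
    proof (rule abelian_groupI)
      fix a :: "nat \<Rightarrow> 'a"
      assume "a \<in> carrier linrec_algebra"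
      \<comment> \<open>Negation is written as scaling by -1 so that
        \<open>linrec_seqs_scale\<close> applies.\<close>
      then have "(\<lambda>n. - 1 * a n) \<in> carrier linrec_algebra"
        unfolding linrec_algebra_def by (simp only: partial_object.simps linrec_seqs_scale)
      then show "\<exists>y\<in>carrier linrec_algebra. y \<oplus>\<^bsub>linrec_algebra\<^esub> a = \<zero>\<^bsub>linrec_algebra\<^esub>"
        by (intro bexI [of _ "\<lambda>n. - 1 * a n"]) (simp_all add: linrec_algebra_def)
    qed (auto simp: linrec_algebra_def linrec_seqs_add linrec_seqs_zero algebra_simps)
    show "comm_monoid (linrec_algebra :: ('a, nat \<Rightarrow> 'a) module)"
      by (rule comm_monoidI)
        (auto simp: linrec_algebra_def linrec_seqs_one closed hurwitz_assoc hurwitz_one_left intro: hurwitz_commute)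
  qed (simp add: linrec_algebra_def hurwitz_add_left)
qed (auto simp: linrec_algebra_def linrec_seqs_scale hurwitz_scale_left algebra_simps)

section \<open>Annihilators of a Hurwitz product\<close>

text \<open>
  The linear functional on R[x, y] that sends x^i y^j to a_i b_j, written in the
  coordinates x and t = x + y of \<^typ>\<open>'a poly poly\<close>: it sends x^k t^n to the n-th
  term of the Hurwitz product of the k-fold shift of a with b.
\<close>

definition bipairing :: "(nat \<Rightarrow> 'a::comm_ring_1) \<Rightarrow> (nat \<Rightarrow> 'a) \<Rightarrow> 'a poly poly \<Rightarrow> 'a" where
  "bipairing a b P = (\<Sum>k\<le>degree P. pairing ((shift ^^ k) a \<star> b) (coeff P k))"

lemma bipairing_0 [simp]: "bipairing a b 0 = 0"
  by (simp add: bipairing_def)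

lemma bipairing_pCons [simp]:
  "bipairing a b (pCons c P) = pairing (a \<star> b) c + bipairing (shift a) b P"
  by (cases "P = 0")
    (simp_all add: bipairing_def sum.atMost_Suc_shift funpow_swap1 del: sum.atMost_Suc)

lemma bipairing_add: "bipairing a b (P + Q) = bipairing a b P + bipairing a b Q"
  by (induction P Q arbitrary: a rule: poly_induct2) (simp_all add: pairing_add algebra_simps)

lemma bipairing_smult_const:
  "bipairing a b (Polynomial.smult [:c:] P) = c * bipairing a b P"
  by (induction P arbitrary: a) (simp_all add: pairing_smult algebra_simps)

text \<open>The combination has the shape of \<open>recurrence_op_pCons\<close>, so that a
  polynomial can be moved onto a sequence one coefficient at a time.\<close>

lemma bipairing_lincomb_left:
  "bipairing (\<lambda>n. c * a n + a' n) b P = c * bipairing a b P + bipairing a' b P"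
proof (induction P arbitrary: a a')
  case (pCons d P)
  have "shift (\<lambda>n. c * a n + a' n) = (\<lambda>n. c * shift a n + shift a' n)"
    by (simp add: fun_eq_iff)
  with pCons.IH [of "shift a" "shift a'"] show ?case
    by (simp add: hurwitz_add_left hurwitz_scale_left pairing_add_seq pairing_scale_seq algebra_simps del: shift_apply)
qed simp

lemma bipairing_lincomb_right:
  "bipairing a (\<lambda>n. c * b n + b' n) P = c * bipairing a b P + bipairing a b' P"
  by (induction P arbitrary: a)
    (simp_all add: hurwitz_add_right hurwitz_scale_right pairing_add_seq pairing_scale_seq algebra_simps)

lemma bipairing_zero_left [simp]: "bipairing (\<lambda>n. 0) b P = 0"
  by (induction P) (simp_all add: shift_def)

lemma bipairing_zero_right [simp]: "bipairing a (\<lambda>n. 0) P = 0"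
  by (induction P arbitrary: a) simp_all

lemma poly_in_x_0 [simp]: "poly_in_x 0 = 0"
  by (simp add: poly_in_x_def)

lemma poly_in_x_pCons [simp]: "poly_in_x (pCons c p) = pCons [:c:] (poly_in_x p)"
  by (cases "pCons c p = 0") (simp_all add: poly_in_x_def map_poly_pCons)

lemma coeff_poly_in_x [simp]: "coeff (poly_in_x p) i = [:coeff p i:]"
  by (simp add: poly_in_x_def coeff_map_poly)

lemma degree_poly_in_x [simp]: "degree (poly_in_x p) = degree p"
  by (simp add: poly_in_x_def degree_map_poly)

lemma poly_t_minus_x_0 [simp]: "poly_t_minus_x 0 = 0"
  by (simp add: poly_t_minus_x_def)

lemma poly_t_minus_x_pCons:
  "poly_t_minus_x (pCons c p) = [:[:c:]:] + [:[:0, 1:], -1:] * poly_t_minus_x p"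
  by (simp add: poly_t_minus_x_def pcompose_pCons)

text \<open>Two-variable adjointness: multiplying by x shifts a, so p(x) is traded for its action on
  a.\<close>

lemma bipairing_poly_in_x:
  "bipairing a b (poly_in_x p * Q) = bipairing (recurrence_op p a) b Q"
proof (induction p arbitrary: a)
  case (pCons c p)
  show ?case
    by (simp add: bipairing_add bipairing_smult_const pCons.IH bipairing_lincomb_left del: shift_apply)
qed simp

text \<open>This is the Leibniz rule for the shift of a Hurwitz product, with y = t - x.\<close>

lemma bipairing_y_mult:
  "bipairing a b ([:[:0, 1:], -1:] * Q) = bipairing a (shift b) Q"
proof (induction Q arbitrary: a)
  case (pCons d Q)
  define Y where "Y = [:[:0, 1:], -1 :: 'a poly:]"
  have "Y * pCons d Q = pCons (pCons 0 d) (Y * Q) + [:0, - d:]"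
    by (simp add: Y_def one_pCons [symmetric])
  \<comment> \<open>The factor t shifts the whole product \<open>a \<star> b\<close>, the factor x
    only a; by Leibniz their difference shifts only b.\<close>
  then have "bipairing a b (Y * pCons d Q)
      = pairing (shift (a \<star> b)) d + bipairing (shift a) b (Y * Q) - pairing (shift a \<star> b) d"
    by (simp add: bipairing_add pairing_uminus del: shift_apply)
  then show ?case
    unfolding Y_def [symmetric]
    by (simp add: pCons.IH [folded Y_def] shift_hurwitz pairing_add_seq del: shift_apply mult_pCons_right)
qed simp

text \<open>Horner's scheme in y = t - x, each factor y shifting b.\<close>

lemma bipairing_poly_t_minus_x:
  "bipairing a b (poly_t_minus_x p * Q) = bipairing a (recurrence_op p b) Q"
proof (induction p arbitrary: b)
  case (pCons c p)
  have "poly_t_minus_x (pCons c p) * Q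
      = Polynomial.smult [:c:] Q + [:[:0, 1:], -1:] * (poly_t_minus_x p * Q)"
    by (simp add: poly_t_minus_x_pCons algebra_simps)
  then show ?case
    by (simp only: bipairing_add bipairing_smult_const bipairing_y_mult pCons.IH
        recurrence_op_pCons bipairing_lincomb_right)
qed simp

text \<open>The value at n is E(t^n r). Since t^n r lies in the ideal, each summand contains a
  generator, which moves onto the sequence that it kills.\<close>

lemma recurrence_op_hurwitz_eq_0:
  assumes "recurrence_op p a = (\<lambda>n. 0)" and "recurrence_op q b = (\<lambda>n. 0)"
    and ideal: "[:r:] = poly_in_x p * U + poly_t_minus_x q * V"
  shows "recurrence_op r (a \<star> b) = (\<lambda>n. 0)"
proof
  fix n
  have "recurrence_op r (a \<star> b) n = pairing (a \<star> b) (Polynomial.monom 1 n * r)"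
    by (simp add: recurrence_op_def pairing_monom_mult)
  also have "\<dots> = bipairing a b ([:r:] * [:Polynomial.monom 1 n:])"
    by (simp add: mult.commute)
  also have "\<dots> = bipairing a b (poly_in_x p * (U * [:Polynomial.monom 1 n:]))
      + bipairing a b (poly_t_minus_x q * (V * [:Polynomial.monom 1 n:]))"
    by (simp only: ideal distrib_right bipairing_add mult.assoc)
  also have "\<dots> = 0"
    by (simp only: bipairing_poly_in_x bipairing_poly_t_minus_x assms(1,2)
        bipairing_zero_left bipairing_zero_right add_0)
  finally show "recurrence_op r (a \<star> b) n = 0" .
qed

text \<open>The last row of \<open>subresultant_mat 0 f g\<close> consists of multiples x^k f and
  x^k g, and the determinant is the resultant. Laplace expansion along that row yields U and V;
  positive total degree ensures that the row exists.\<close>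

lemma resultant_in_ideal:
  fixes f g :: "'a::comm_ring_1 poly"
  assumes pos: "0 < degree f + degree g"
  obtains U V where "[:resultant f g:] = f * U + g * V"
proof -
  define m n where "m = degree f" and "n = degree g"
  define A where "A = subresultant_mat 0 f g"
  have carrier: "A \<in> carrier_mat (m + n) (m + n)"
    by (auto simp: A_def m_def n_def)
  define X where "X j = A $$ (m + n - 1, j)" for j
  define C where "C j = cofactor A (m + n - 1) j" for j
  have X_f: "X j = f * Polynomial.monom 1 (n - 1 - j)" if "j < n" for j
    using that pos unfolding X_def A_def by (subst subresultant_index_mat) (auto simp: m_def n_def mult.commute)
  have X_g: "X (n + j) = g * Polynomial.monom 1 (m - 1 - j)" if "j < m" for j
    using that pos unfolding X_def A_def by (subst subresultant_index_mat) (auto simp: m_def n_def mult.commute)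
  have "[:resultant f g:] = det A"
    by (simp add: A_def subresultant_resultant [symmetric] subresultant_def)
  also have "\<dots> = (\<Sum>j<m + n. X j * C j)"
    unfolding X_def C_def by (rule laplace_expansion_row [OF carrier]) (use pos in \<open>simp add: m_def n_def\<close>)
  also have "\<dots> = (\<Sum>j<n. X j * C j) + (\<Sum>j<m. X (n + j) * C (n + j))"
    unfolding add.commute [of m n] by (induction m) (simp_all add: add.assoc)
  also have "(\<Sum>j<n. X j * C j) = f * (\<Sum>j<n. Polynomial.monom 1 (n - 1 - j) * C j)"
    unfolding sum_distrib_left by (rule sum.cong) (simp_all add: X_f mult.assoc)
  also have "(\<Sum>j<m. X (n + j) * C (n + j)) = g * (\<Sum>j<m. Polynomial.monom 1 (m - 1 - j) * C (n + j))"
    unfolding sum_distrib_left by (rule sum.cong) (simp_all add: X_g mult.assoc)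
  finally show thesis
    by (rule that)
qed

text \<open>Binomial theorem: x^j t^k occurs only in the expansion of (t - x)^(j + k). In particular
  the total degree in x and t is bounded by that of p.\<close>

lemma coeff_poly_t_minus_x:
  "coeff (coeff (poly_t_minus_x p) j) k = (- 1) ^ j * of_nat ((j + k) choose j) * coeff p (j + k)"
proof (induction p arbitrary: j k)
  case (pCons c p)
  define Q where "Q = poly_t_minus_x p"
  have step: "poly_t_minus_x (pCons c p) = [:[:c:]:] + (Polynomial.smult [:0, 1:] Q - pCons 0 Q)"
    by (simp add: poly_t_minus_x_pCons Q_def one_pCons [symmetric])
  note IH = pCons.IH [folded Q_def]
  show ?case
    unfolding step
    by (cases j; cases k) (simp_all add: IH binomial_eq_0 algebra_simps)
qed simp

lemma coeff_poly_t_minus_x_degree: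
  assumes "lead_coeff p = 1"
  shows "coeff (poly_t_minus_x p) (degree p) = [:(- 1) ^ degree p:]"
  using assms by (intro poly_eqI) (auto simp: coeff_poly_t_minus_x coeff_pCons coeff_eq_0 split: nat.split)

text \<open>The leading coefficient in x is a sign, nonzero as 1 \<noteq> 0, so the Sylvester matrix
  has the expected size.\<close>

lemma degree_poly_t_minus_x:
  assumes "lead_coeff p = 1"
  shows "degree (poly_t_minus_x p) = degree p"
proof (rule antisym)
  show "degree (poly_t_minus_x p) \<le> degree p"
    by (rule degree_le) (simp add: poly_eq_iff coeff_poly_t_minus_x coeff_eq_0)
  have "(- 1) ^ degree p \<noteq> (0 :: 'a)"
    by (cases "even (degree p)") simp_all
  then show "degree p \<le> degree (poly_t_minus_x p)"
    by (intro le_degree) (simp add: coeff_poly_t_minus_x_degree [OF assms])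
qed

section \<open>The resultant over a commutative ring\<close>

text \<open>Formal bounds replace degrees: degrees of products may drop when there are zero
  divisors, but coefficients at the bounds still multiply.\<close>

lemma coeff_mult_at_bound:
  assumes "degree p \<le> m" and "degree q \<le> n"
  shows "coeff (p * q) (m + n) = coeff p m * coeff q n"
proof -
  have "coeff p i * coeff q (m + n - i) = 0" if "i \<le> m + n" "i \<noteq> m" for i
    using assms that by (cases "i < m") (simp_all add: coeff_eq_0)
  then have "coeff (p * q) (m + n) = (\<Sum>i\<in>{m}. coeff p i * coeff q (m + n - i))"
    unfolding coeff_mult by (intro sum.mono_neutral_right) auto
  then show ?thesis
    by simp
qed

lemma coeff_prod_at_bound:
  fixes f :: "nat \<Rightarrow> 'a::comm_ring_1 poly"
  assumes "\<And>j. j < n \<Longrightarrow> degree (f j) \<le> v j"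
  shows "degree (\<Prod>j<n. f j) \<le> (\<Sum>j<n. v j) \<and>
    coeff (\<Prod>j<n. f j) (\<Sum>j<n. v j) = (\<Prod>j<n. coeff (f j) (v j))"
  using assms
proof (induction n)
  case (Suc n)
  then have IH: "degree (\<Prod>j<n. f j) \<le> (\<Sum>j<n. v j)"
      "coeff (\<Prod>j<n. f j) (\<Sum>j<n. v j) = (\<Prod>j<n. coeff (f j) (v j))"
    and f: "degree (f n) \<le> v n"
    by simp_all
  have "degree ((\<Prod>j<n. f j) * f n) \<le> (\<Sum>j<n. v j) + v n"
    by (rule order_trans [OF degree_mult_le]) (intro add_mono IH f)
  then show ?case
    by (simp add: coeff_mult_at_bound IH f)
qed simp

text \<open>Each Leibniz term takes one entry from every column, so the column bounds add up and the
  coefficients at the bounds multiply.\<close>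

lemma coeff_det_at_bound:
  fixes A :: "'a::comm_ring_1 poly mat"
  assumes A: "A \<in> carrier_mat n n"
    and deg: "\<And>i j. i < n \<Longrightarrow> j < n \<Longrightarrow> degree (A $$ (i, j)) \<le> v j"
  shows "degree (det A) \<le> (\<Sum>j<n. v j)"
    and "coeff (det A) (\<Sum>j<n. v j) = det (mat n n (\<lambda>(i, j). coeff (A $$ (i, j)) (v j)))"
proof -
  define S where "S = (\<Sum>j<n. v j)"
  define T where "T p = (\<Prod>j<n. A $$ (p j, j))" for p
  have T: "degree (T p) \<le> S" "coeff (T p) S = (\<Prod>j<n. coeff (A $$ (p j, j)) (v j))"
    if "p permutes {0..<n}" for p
  proof -
    have "p j < n" if "j < n" for j
      using permutes_in_image [OF \<open>p permutes {0..<n}\<close>, of j] that by simp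
    then show "degree (T p) \<le> S" "coeff (T p) S = (\<Prod>j<n. coeff (A $$ (p j, j)) (v j))"
      using coeff_prod_at_bound [of n "\<lambda>j. A $$ (p j, j)" v] deg by (simp_all add: T_def S_def)
  qed
  have det_A: "det A = (\<Sum>p | p permutes {0..<n}. Polynomial.smult (signof p) (T p))"
    unfolding det_col [OF A] T_def by (simp only: of_int_poly mult_pCons_left mult_zero_left pCons_0_0 add_0_right)
  show "degree (det A) \<le> S"
    unfolding det_A
    by (intro degree_sum_le) (auto simp: finite_permutations intro: order_trans [OF degree_smult_le] T)
  have "coeff (det A) S
      = (\<Sum>p | p permutes {0..<n}. signof p * (\<Prod>j<n. coeff (A $$ (p j, j)) (v j)))"
    unfolding det_A by (simp add: coeff_sum T)
  also have "\<dots> = (\<Sum>p | p permutes {0..<n}. signof p *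
      (\<Prod>j<n. mat n n (\<lambda>(i, j). coeff (A $$ (i, j)) (v j)) $$ (p j, j)))"
  proof (rule sum.cong [OF refl], rule arg_cong [of _ _ "(*) _"], rule prod.cong [OF refl])
    fix p j
    assume "p \<in> {p. p permutes {0..<n}}" "j \<in> {..<n}"
    then show "coeff (A $$ (p j, j)) (v j) = mat n n (\<lambda>(i, j). coeff (A $$ (i, j)) (v j)) $$ (p j, j)"
      using permutes_in_image [of p "{0..<n}" j] by simp
  qed
  also have "\<dots> = det (mat n n (\<lambda>(i, j). coeff (A $$ (i, j)) (v j)))"
    by (rule det_col [symmetric]) simp
  finally show "coeff (det A) S = det (mat n n (\<lambda>(i, j). coeff (A $$ (i, j)) (v j)))" .
qed

lemma det_scale_rows:
  assumes A: "A \<in> carrier_mat n n"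
  shows "det (mat n n (\<lambda>(i, j). c i * A $$ (i, j))) = (\<Prod>i<n. c i) * det A"
proof -
  define B where "B = mat n n (\<lambda>(i, j). c i * A $$ (i, j))"
  have B: "B \<in> carrier_mat n n"
    by (simp add: B_def)
  have *: "(\<Prod>i = 0..<n. B $$ (i, p i)) = (\<Prod>i<n. c i) * (\<Prod>i = 0..<n. A $$ (i, p i))"
    if "p permutes {0..<n}" for p
    unfolding lessThan_atLeast0 prod.distrib [symmetric]
  proof (rule prod.cong [OF refl])
    fix i assume "i \<in> {0..<n}"
    then show "B $$ (i, p i) = c i * A $$ (i, p i)"
      using permutes_in_image [OF that, of i] by (simp add: B_def)
  qed
  have "det B = (\<Prod>i<n. c i) * det A"
    unfolding det_def' [OF A] det_def' [OF B] sum_distrib_left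
    by (rule sum.cong) (simp_all only: mem_Collect_eq * mult.left_commute)
  then show ?thesis
    by (simp add: B_def)
qed

lemma prod_monom_1: "(\<Prod>i\<in>S. Polynomial.monom 1 (w i)) = (Polynomial.monom 1 (\<Sum>i\<in>S. w i) :: 'a::comm_ring_1 poly)"
  by (induction S rule: infinite_finite_induct) (simp_all add: mult_monom)

text \<open>Undoes the scaling of rows by powers of t. The coefficient 1 makes the bound d exact, so
  r has degree d - w.\<close>

lemma lead_coeff_monom_multD:
  fixes r :: "'a::comm_ring_1 poly"
  assumes deg: "degree (Polynomial.monom 1 w * r) \<le> d" and top: "coeff (Polynomial.monom 1 w * r) d = 1"
  shows "lead_coeff r = 1"
proof -
  have "w \<le> d" and "coeff r (d - w) = 1"
    using top by (simp_all add: coeff_monom_mult split: if_splits)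
  moreover have "coeff r k = 0" if "d - w < k" for k
  proof -
    have "coeff (Polynomial.monom 1 w * r) (k + w) = 0"
      using that deg by (intro coeff_eq_0) linarith
    then show ?thesis
      by (simp add: coeff_monom_mult)
  qed
  ultimately have "degree r = d - w"
    by (intro antisym degree_le le_degree) auto
  with \<open>coeff r (d - w) = 1\<close> show ?thesis
    by simp
qed

lemma det_lower_unitriangular:
  assumes "\<And>i j. i < j \<Longrightarrow> j < n \<Longrightarrow> A $$ (i, j) = 0" and "\<And>i. i < n \<Longrightarrow> A $$ (i, i) = 1"
    and "A \<in> carrier_mat n n"
  shows "det A = 1"
  using assms by (subst det_lower_triangular [of n A]) (auto simp: prod_list_diag_prod)

lemma det_upper_unitriangular:
  assumes "\<And>i j. j < i \<Longrightarrow> i < n \<Longrightarrow> A $$ (i, j) = 0" and "\<And>i. i < n \<Longrightarrow> A $$ (i, i) = 1"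
    and "A \<in> carrier_mat n n"
  shows "det A = 1"
  using assms by (subst det_upper_triangular [of A n]) (auto simp: prod_list_diag_prod)

text \<open>
  Multiplying the i-th row of each of the two blocks of the Sylvester matrix by t^i gives
  a matrix whose j-th column has degree at most j in t; the coefficients of t^j form a
  lower unitriangular matrix.
\<close>

lemma lead_coeff_resultant_t_minus_x:
  fixes p q :: "'a::comm_ring_1 poly"
  assumes p: "lead_coeff p = 1" and q: "lead_coeff q = 1"
  shows "lead_coeff (resultant (poly_in_x p) (poly_t_minus_x q)) = 1"
proof -
  define m n where "m = degree p" and "n = degree q"
  define A where "A = sylvester_mat (poly_in_x p) (poly_t_minus_x q)"
  \<comment> \<open>The position of a row within its block: n rows for p come first, then m rows for
    q.\<close>
  define w where "w i = (if i < n then i else i - n)" for i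
  define B where "B = mat (m + n) (m + n) (\<lambda>(i, j). Polynomial.monom 1 (w i) * A $$ (i, j))"
  have A: "A \<in> carrier_mat (m + n) (m + n)"
    by (auto simp: A_def m_def n_def degree_poly_t_minus_x [OF q])
  have B: "B \<in> carrier_mat (m + n) (m + n)"
    by (simp add: B_def)
  have entry: "A $$ (i, j) = (if i < n
      then if i \<le> j \<and> j - i \<le> m then [:coeff p (m + i - j):] else 0
      else if i - n \<le> j \<and> j \<le> i then coeff (poly_t_minus_x q) (i - j) else 0)"
    if "i < m + n" "j < m + n" for i j
    using that unfolding A_def
    by (subst sylvester_index_mat) (simp_all add: m_def n_def degree_poly_t_minus_x [OF q])
  have coeff_B: "coeff (B $$ (i, j)) k = (if k < w i then 0 else coeff (A $$ (i, j)) (k - w i))"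
    if "i < m + n" "j < m + n" for i j k
    using that by (simp add: B_def coeff_monom_mult)
  \<comment> \<open>In the first block the entry is t^i times a constant and vanishes unless i \<le>
    j. In the second it is t^(i - n) times the coefficient of x^(i - j) in q(t - x), which has
    degree at most n - (i - j).\<close>
  have deg_B: "degree (B $$ (i, j)) \<le> j" if ij: "i < m + n" "j < m + n" for i j
    by (rule degree_le)
      (auto simp: coeff_B entry ij w_def coeff_pCons coeff_poly_t_minus_x n_def [symmetric] coeff_eq_0 split: nat.split)
  have det_B: "degree (det B) \<le> (\<Sum>j<m + n. j)"
    "coeff (det B) (\<Sum>j<m + n. j) = det (mat (m + n) (m + n) (\<lambda>(i, j). coeff (B $$ (i, j)) j))"
    using deg_B by (auto intro!: coeff_det_at_bound [OF B])
  have "det B = Polynomial.monom 1 (\<Sum>i<m + n. w i) * det A"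
    unfolding B_def det_scale_rows [OF A] prod_monom_1 ..
  \<comment> \<open>The diagonal consists of the leading coefficients of p and q. Above it, a
    first-block entry has only the power t^i with i < j, and a second-block entry is 0.\<close>
  moreover have "coeff (det B) (\<Sum>j<m + n. j) = 1"
    unfolding det_B(2)
    using p [folded m_def] q [folded n_def]
    by (intro det_lower_unitriangular [of "m + n"])
      (auto simp: coeff_B entry w_def coeff_poly_t_minus_x coeff_pCons split: nat.split)
  ultimately show ?thesis
    using det_B(1) lead_coeff_monom_multD
    by (metis A_def resultant_def)
qed

section \<open>Product formula for a resultant whose first argument splits\<close>

text \<open>Rows are coefficient vectors of x^k f and x^k g in descending order, so row operations
  become polynomial identities.\<close>

lemma sylvester_mat_sub_eq:
  fixes f g :: "'a::comm_ring_1 poly"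
  assumes "degree f \<le> m" and "degree g \<le> n"
  shows "sylvester_mat_sub m n f g = mat (m + n) (m + n) (\<lambda>(i, j). coeff (if i < n
    then Polynomial.monom 1 (n - 1 - i) * f else Polynomial.monom 1 (m + n - 1 - i) * g) (m + n - 1 - j))"
  using assms by (intro eq_matI) (auto simp: sylvester_mat_sub_index coeff_monom_mult intro!: coeff_eq_0 arg_cong [of _ _ "coeff _"])

text \<open>Synthetic division: each partial sum is c times the previous one plus the next
  coefficient. This yields the coefficients of the quotient P, then the remainder 0.\<close>

lemma horner_coeffs_linear_mult:
  fixes P :: "'a::comm_ring_1 poly"
  assumes "degree P < K" and "j \<le> K"
  shows "(\<Sum>i\<le>j. coeff ([:- c, 1:] * P) (K - i) * c ^ (j - i)) = (if j < K then coeff P (K - 1 - j) else 0)"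
proof -
  have coeff_mult: "coeff ([:- c, 1:] * P) k = (if k = 0 then 0 else coeff P (k - 1)) - c * coeff P k" for k
    by (cases k) simp_all
  show ?thesis
    using \<open>j \<le> K\<close>
  proof (induction j)
    case 0
    with assms show ?case
      by (cases K) (simp_all add: coeff_eq_0)
  next
    case (Suc j)
    have "(\<Sum>i\<le>j. coeff ([:- c, 1:] * P) (K - i) * c ^ (Suc j - i))
        = c * (\<Sum>i\<le>j. coeff ([:- c, 1:] * P) (K - i) * c ^ (j - i))"
      by (auto simp: sum_distrib_left Suc_diff_le algebra_simps intro!: sum.cong)
    also have "\<dots> = c * coeff P (K - 1 - j)"
      using Suc by simp
    finally have "(\<Sum>i\<le>Suc j. coeff ([:- c, 1:] * P) (K - i) * c ^ (Suc j - i))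
        = c * coeff P (K - 1 - j) + coeff ([:- c, 1:] * P) (K - Suc j)"
      by (simp del: mult_pCons_left)
    also have "\<dots> = (if Suc j < K then coeff P (K - 1 - Suc j) else 0)"
      unfolding coeff_mult using Suc.prems by auto
    finally show ?case .
  qed
qed

lemma horner_coeffs_eq_poly:
  fixes P :: "'a::comm_ring_1 poly"
  assumes "degree P \<le> K"
  shows "(\<Sum>i\<le>K. coeff P (K - i) * c ^ (K - i)) = poly P c"
proof -
  have "(\<Sum>i\<le>K. coeff P (K - i) * c ^ (K - i)) = (\<Sum>i\<le>K. coeff P i * c ^ i)"
    by (rule sum.reindex_bij_witness [of _ "\<lambda>i. K - i" "\<lambda>i. K - i"]) auto
  also have "\<dots> = poly P c"
    unfolding poly_altdef using assms by (intro sum.mono_neutral_right) (auto simp: coeff_eq_0)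
  finally show ?thesis .
qed

text \<open>
  Row operations turn all rows but the last into multiples of x - c. The column operations
  given by the powers of c then perform synthetic division by x - c, with the remainder
  (the value at c) in the last column.
\<close>

lemma resultant_sub_linear_mult:
  fixes f g :: "'a::comm_ring_1 poly"
  assumes f: "degree f \<le> m" and g: "degree g \<le> n"
  shows "resultant_sub (Suc m) n ([:- c, 1:] * f) g = poly g c * resultant_sub m n f g"
proof -
  define K where "K = m + n"
  define P where "P i = (if i < n then Polynomial.monom 1 (n - 1 - i) * f
    else Polynomial.monom 1 (K - 1 - i) * g)" for i
  define P' where "P' i = (if i < n then Polynomial.monom 1 (n - 1 - i) * ([:- c, 1:] * f)
    else Polynomial.monom 1 (K - i) * g)" for i
  define S where "S = sylvester_mat_sub m n f g"
  define S' where "S' = sylvester_mat_sub (Suc m) n ([:- c, 1:] * f) g"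
  \<comment> \<open>Subtracts c times the following row within the block of g, since x^(k+1) g - c
    x^k g = (x - c) x^k g.\<close>
  define L where "L = mat (Suc K) (Suc K) (\<lambda>(i, j).
    if i = j then 1 else if j = Suc i \<and> n \<le> i then - c else 0)"
  \<comment> \<open>Multiplying by this on the right replaces each row by its Horner partial
    sums.\<close>
  define V where "V = mat (Suc K) (Suc K) (\<lambda>(i, j). if i \<le> j then c ^ (j - i) else 0)"
  define R where "R i = (if i < K then [:- c, 1:] * P i else g)" for i
  have S: "S = mat K K (\<lambda>(i, j). coeff (P i) (K - 1 - j))"
    unfolding S_def sylvester_mat_sub_eq [OF f g] P_def K_def by simp
  have deg_f': "degree ([:- c, 1:] * f) \<le> Suc m"
    by (rule order_trans [OF degree_mult_le]) (use f in \<open>simp add: degree_pCons_eq_if\<close>)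
  have S': "S' = mat (Suc K) (Suc K) (\<lambda>(i, j). coeff (P' i) (K - j))"
    unfolding S'_def sylvester_mat_sub_eq [OF deg_f' g] P'_def K_def by (simp cong: if_cong)
  have deg_P: "degree (P i) < K" if "i < K" for i
    using that f g unfolding P_def K_def
    by (auto intro!: le_less_trans [OF degree_mult_le] le_less_trans [OF add_right_mono [OF degree_monom_le]])
  have row_step: "P' i - (if n \<le> i \<and> i < K then Polynomial.smult c (P' (Suc i)) else 0) = R i"
    if i: "i \<le> K" for i
  proof -
    consider "i < n" | "n \<le> i" "i < K" | "i = K"
      using i by linarith
    then show ?thesis
    proof cases
      case 2
      have "Polynomial.monom 1 (K - i) = pCons 0 (Polynomial.monom (1 :: 'a) (K - Suc i))"
        using 2 by (simp add: Polynomial.monom_Suc [symmetric] Suc_diff_Suc)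
      then show ?thesis
        using 2 by (simp add: P'_def R_def P_def algebra_simps)
    qed (auto simp: P'_def R_def P_def K_def algebra_simps)
  qed
  have LS': "L * S' = mat (Suc K) (Suc K) (\<lambda>(i, j). coeff (R i) (K - j))"
  proof (rule eq_matI)
    fix i j
    assume "i < dim_row (mat (Suc K) (Suc K) (\<lambda>(i, j). coeff (R i) (K - j)))"
      and "j < dim_col (mat (Suc K) (Suc K) (\<lambda>(i, j). coeff (R i) (K - j)))"
    then have ij: "i < Suc K" "j < Suc K"
      by simp_all
    have "(L * S') $$ (i, j) = (\<Sum>k<Suc K. (if i = k then 1 else if k = Suc i \<and> n \<le> i then - c else 0)
        * coeff (P' k) (K - j))"
      using ij by (simp add: L_def S' scalar_prod_def lessThan_atLeast0 del: sum.lessThan_Suc sum.op_ivl_Suc)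
    also have "\<dots> = (\<Sum>k<Suc K. (if i = k then coeff (P' k) (K - j) else 0)
        + (if Suc i = k then (if n \<le> i then - c * coeff (P' k) (K - j) else 0) else 0))"
      by (rule sum.cong) auto
    also have "\<dots> = coeff (P' i - (if n \<le> i \<and> i < K then Polynomial.smult c (P' (Suc i)) else 0)) (K - j)"
      using ij by (auto simp: sum.distrib simp del: sum.lessThan_Suc)
    also have "\<dots> = coeff (R i) (K - j)"
      using ij by (simp add: row_step)
    finally show "(L * S') $$ (i, j) = mat (Suc K) (Suc K) (\<lambda>(i, j). coeff (R i) (K - j)) $$ (i, j)"
      using ij by simp
  qed (simp_all add: L_def S')
  define T where "T i j = (\<Sum>k\<le>j. coeff (R i) (K - k) * c ^ (j - k))" for i j
  have LS'V: "(L * S') * V = mat (Suc K) (Suc K) (\<lambda>(i, j). T i j)"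
  proof (rule eq_matI)
    fix i j
    assume "i < dim_row (mat (Suc K) (Suc K) (\<lambda>(i, j). T i j))"
      and "j < dim_col (mat (Suc K) (Suc K) (\<lambda>(i, j). T i j))"
    then have ij: "i < Suc K" "j < Suc K"
      by simp_all
    have "((L * S') * V) $$ (i, j) = (\<Sum>k<Suc K. coeff (R i) (K - k) * (if k \<le> j then c ^ (j - k) else 0))"
      using ij by (simp add: LS' V_def scalar_prod_def lessThan_atLeast0 del: sum.lessThan_Suc sum.op_ivl_Suc)
    also have "\<dots> = T i j"
      unfolding T_def using ij by (intro sum.mono_neutral_cong_right) auto
    finally show "((L * S') * V) $$ (i, j) = mat (Suc K) (Suc K) (\<lambda>(i, j). T i j) $$ (i, j)"
      using ij by simp
  qed (simp_all add: LS' V_def)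
  have T: "T i j = (if j < K then coeff (P i) (K - 1 - j) else 0)" if "i < K" "j \<le> K" for i j
    using horner_coeffs_linear_mult [OF deg_P [OF \<open>i < K\<close>] \<open>j \<le> K\<close>] that by (simp add: T_def R_def)
  have T_last: "T K K = poly g c"
    using horner_coeffs_eq_poly [of g K c] g by (simp add: T_def R_def K_def)
  \<comment> \<open>The first K rows have remainder 0 in the last column, so the matrix is block
    triangular with corner g(c).\<close>
  have "(L * S') * V = four_block_mat S (0\<^sub>m K 1) (mat 1 K (\<lambda>(i, j). T K j)) (mat 1 1 (\<lambda>_. poly g c))"
    unfolding LS'V by (rule eq_matI) (auto simp: S T T_last less_Suc_eq)
  then have "det ((L * S') * V) = det S * det (mat 1 1 (\<lambda>_. poly g c))"
    by (simp only:) (rule det_four_block_mat_upper_right_zero_col [OF _ refl mat_carrier mat_carrier], simp add: S)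
  also have "\<dots> = det S * poly g c"
    by (simp add: det_single)
  finally have "det ((L * S') * V) = det S * poly g c" .
  moreover have "det ((L * S') * V) = det S'"
  proof -
    have carriers: "L \<in> carrier_mat (Suc K) (Suc K)" "S' \<in> carrier_mat (Suc K) (Suc K)"
      "V \<in> carrier_mat (Suc K) (Suc K)"
      by (simp_all add: L_def S' V_def)
    have "det L = 1" "det V = 1"
      by (rule det_upper_unitriangular [OF _ _ carriers(1)]; simp add: L_def)
         (rule det_upper_unitriangular [OF _ _ carriers(3)]; simp add: V_def)
    with carriers show ?thesis
      by (simp add: det_mult [of _ "Suc K"])
  qed
  ultimately show ?thesis
    by (simp add: resultant_sub_def S_def S'_def mult.commute)
qed

text \<open>Linear factors are peeled off one at a time; the formal degree m counts them, so a
  degree bound suffices.\<close>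

lemma resultant_sub_prod_linear:
  fixes g :: "'a::comm_ring_1 poly"
  assumes g: "degree g \<le> n"
  shows "resultant_sub m n (\<Prod>i=1..m. [:- c i, 1:]) g = (\<Prod>i=1..m. poly g (c i))"
proof (induction m)
  case 0
  \<comment> \<open>Only the n rows of multiples x^k of 1 remain, and they form the
    identity.\<close>
  have "sylvester_mat_sub 0 n 1 g = 1\<^sub>m n"
    by (rule eq_matI) (auto simp: sylvester_mat_sub_index)
  then show ?case
    by (simp add: resultant_sub_def)
next
  case (Suc m)
  have "degree (\<Prod>i=1..m. [:- c i, 1:]) \<le> m"
    by (rule order_trans [OF degree_prod_sum_le]) simp_all
  from resultant_sub_linear_mult [OF this g, of "c (Suc m)"] Suc show ?case
    by (simp add: mult.commute del: mult_pCons_left mult_pCons_right)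
qed

section \<open>Roots in an extension ring\<close>

lemma poly_in_x_prod_linear:
  "poly_in_x (\<Prod>i\<in>I. [:- c i, 1:]) = (\<Prod>i\<in>I. [:[:- c i:], 1:])"
proof -
  interpret lift: map_poly_comm_ring_hom "\<lambda>c :: 'a. [:c:]"
    by unfold_locales
  show ?thesis
    unfolding poly_in_x_def by (simp add: lift.hom_prod one_pCons [symmetric])
qed

text \<open>Moves the resultant to a ring containing the roots. Injectivity preserves the degrees in
  x, hence the shape of the Sylvester matrix.\<close>

lemma map_poly_resultant_t_minus_x:
  fixes \<phi> :: "'a::comm_ring_1 \<Rightarrow> 's::comm_ring_1"
  assumes "inj_comm_ring_hom \<phi>"
  shows "map_poly \<phi> (resultant (poly_in_x p) (poly_t_minus_x q))
    = resultant (poly_in_x (map_poly \<phi> p)) (poly_t_minus_x (map_poly \<phi> q))"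
proof -
  interpret \<phi>: inj_comm_ring_hom \<phi> by fact
  interpret map_\<phi>: map_poly_inj_comm_ring_hom \<phi> ..
  have "map_poly (map_poly \<phi>) (poly_in_x p) = poly_in_x (map_poly \<phi> p)"
    by (intro poly_eqI) (simp add: hom_distribs)
  moreover have "map_poly (map_poly \<phi>) (poly_t_minus_x q) = poly_t_minus_x (map_poly \<phi> q)"
    by (intro poly_eqI) (simp add: coeff_poly_t_minus_x hom_distribs)
  ultimately show ?thesis
    using map_\<phi>.resultant_hom [of "poly_in_x p" "poly_t_minus_x q"] by simp
qed

text \<open>Over R[t] the resultant is the product of the values of q(t - x) at x = \<alpha>_i, and
  each q(t - \<alpha>_i) factors through the roots of q.\<close>

lemma resultant_t_minus_x_split:
  fixes p q :: "'a::comm_ring_1 poly"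
  assumes p: "p = (\<Prod>i=1..m. [:- \<alpha> i, 1:])" "degree p = m"
    and q: "q = (\<Prod>j=1..n. [:- \<beta> j, 1:])"
  shows "resultant (poly_in_x p) (poly_t_minus_x q) = (\<Prod>i=1..m. \<Prod>j=1..n. [:- (\<alpha> i + \<beta> j), 1:])"
proof -
  have p_in_x: "poly_in_x p = (\<Prod>i=1..m. [:- [:\<alpha> i:], 1:])"
    by (simp only: p(1) poly_in_x_prod_linear minus_pCons minus_zero)
  have "resultant (poly_in_x p) (poly_t_minus_x q)
      = resultant_sub m (degree (poly_t_minus_x q)) (\<Prod>i=1..m. [:- [:\<alpha> i:], 1:]) (poly_t_minus_x q)"
    by (simp only: resultant_sub degree_poly_in_x p(2)) (simp only: p_in_x)
  also have "\<dots> = (\<Prod>i=1..m. poly (poly_t_minus_x q) [:\<alpha> i:])"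
    by (rule resultant_sub_prod_linear) simp
  also have "\<dots> = (\<Prod>i=1..m. \<Prod>j=1..n. [:- (\<alpha> i + \<beta> j), 1:])"
    by (intro prod.cong refl)
      (simp only: poly_t_minus_x_def poly_pcompose q poly_in_x_prod_linear poly_prod, simp add: minus_diff_commute)
  finally show ?thesis .
qed

lemma has_char_poly_hurwitz:
  assumes a: "has_char_poly a p" and b: "has_char_poly b q"
  shows "has_char_poly (a \<star> b) (resultant (poly_in_x p) (poly_t_minus_x q))"
proof -
  have p: "lead_coeff p = 1" "recurrence_op p a = (\<lambda>n. 0)"
    and q: "lead_coeff q = 1" "recurrence_op q b = (\<lambda>n. 0)"
    using a b by (simp_all add: has_char_poly_iff)
  have "\<exists>U V. [:resultant (poly_in_x p) (poly_t_minus_x q):] = poly_in_x p * U + poly_t_minus_x q * V"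
  proof (cases "degree p + degree q = 0")
    \<comment> \<open>The Sylvester matrix is empty, so there is no row to expand; but p = 1
      generates the unit ideal.\<close>
    case True
    then have "p = 1"
      using p(1) by (metis add_is_0 degree_0_id one_pCons)
    then have "poly_in_x p = 1"
      by (simp add: poly_in_x_def)
    then show ?thesis
      by (metis mult_1 mult_zero_right add_0_right)
  next
    case False
    then have "0 < degree (poly_in_x p) + degree (poly_t_minus_x q)"
      by (simp add: degree_poly_t_minus_x [OF q(1)])
    then show ?thesis
      by (rule resultant_in_ideal) blast
  qed
  then have "recurrence_op (resultant (poly_in_x p) (poly_t_minus_x q)) (a \<star> b) = (\<lambda>n. 0)"
    using recurrence_op_hurwitz_eq_0 [OF p(2) q(2)] by blast
  with lead_coeff_resultant_t_minus_x [OF p(1) q(1)] show ?thesis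
    by (simp add: has_char_poly_iff)
qed

theorem theorem5:
  fixes a b :: "nat \<Rightarrow> 'a::comm_ring_1"
    and p\<^sub>a p\<^sub>b :: "'a poly"
    and M N :: nat
  assumes "has_char_poly a p\<^sub>a" and "degree p\<^sub>a = M"
    and "has_char_poly b p\<^sub>b" and "degree p\<^sub>b = N"
  shows "a \<star> b \<in> linrec_seqs
    \<and> has_char_poly (a \<star> b) (resultant (poly_in_x p\<^sub>a) (poly_t_minus_x p\<^sub>b))
    \<and> (\<forall>(\<phi> :: 'a \<Rightarrow> 's::comm_ring_1) \<alpha> \<beta>.
          inj_comm_ring_hom \<phi>
          \<longrightarrow> map_poly \<phi> p\<^sub>a = (\<Prod>i=1..M. [:- \<alpha> i, 1:])
          \<longrightarrow> map_poly \<phi> p\<^sub>b = (\<Prod>j=1..N. [:- \<beta> j, 1:])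
          \<longrightarrow> map_poly \<phi> (resultant (poly_in_x p\<^sub>a) (poly_t_minus_x p\<^sub>b))
              = (\<Prod>i=1..M. \<Prod>j=1..N. [:- (\<alpha> (i::nat) + \<beta> (j::nat)), 1:]))
    \<and> algebra (class_ring :: 'a ring) linrec_algebra"
proof (intro conjI allI impI)
  show "has_char_poly (a \<star> b) (resultant (poly_in_x p\<^sub>a) (poly_t_minus_x p\<^sub>b))"
    using assms by (intro has_char_poly_hurwitz)
  then show "a \<star> b \<in> linrec_seqs"
    by (auto simp: linrec_seqs_def)
  show "algebra (class_ring :: 'a ring) linrec_algebra"
    by (rule algebra_linrec) (auto simp: linrec_seqs_def intro: has_char_poly_hurwitz)
next
  fix \<phi> :: "'a \<Rightarrow> 's" and \<alpha> \<beta>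
  assume \<phi>: "inj_comm_ring_hom \<phi>"
    and p: "map_poly \<phi> p\<^sub>a = (\<Prod>i=1..M. [:- \<alpha> i, 1:])"
    and q: "map_poly \<phi> p\<^sub>b = (\<Prod>j=1..N. [:- \<beta> j, 1:])"
  interpret inj_comm_ring_hom \<phi> by fact
  \<comment> \<open>Injectivity keeps the degree, which must equal the number of linear factors for
    \<open>resultant_t_minus_x_split\<close>.\<close>
  have "degree (map_poly \<phi> p\<^sub>a) = M"
    using assms(2) by simp
  then show "map_poly \<phi> (resultant (poly_in_x p\<^sub>a) (poly_t_minus_x p\<^sub>b))
      = (\<Prod>i=1..M. \<Prod>j=1..N. [:- (\<alpha> (i::nat) + \<beta> (j::nat)), 1:])"
    unfolding map_poly_resultant_t_minus_x [OF \<phi>] using p q by (intro resultant_t_minus_x_split)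
qed

end
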